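(* Consider an irreducible, aperiodic, positive recurrent and reversible continuous-time Markov chain on a countable state space $S$ with generator $\mathcal L$ and stationary distribution $\nu$. Assume: (1) there are functions $V:S\to[1,\infty)$, $b:S\to[0,\infty)$ and a constant $\gamma>0$ such that $$\mathcal LV(q)\le-\gamma V(q)+b(q)\qquad\forall q\in S;$$ (2) $\sum_{q\in S}b(q)\nu(q)<\infty$, and, with $K=\{q\in S:b(q)>0\}$ (nonempty), $\nu(K)=\sum_{q\in K}\nu(q)$ and $\tau(q)=\frac{b(q)\nu(q)}{\sum_{x\in S}b(x)\nu(x)}$ for $q\in S$, there is a constant $C_b\ge0$ such that $$\mathrm{Var}_\tau(f)\le\frac{C_b}{\nu(K)}\langle f,-\mathcal Lf\rangle_\nu\qquad\forall f\in\ell_{2,\nu}.$$ Let $\nu_K(q)=\nu(q)/\nu(K)$ for $q\in K$ and $\nu_K(q)=0$ otherwise. Then $$\mathrm{Var}_\nu(f)\le\frac{1+\left(\sum_{q\in S}b(q)\nu_K(q)\right)C_b}{\gamma}\,\langle f,-\mathcal Lf\rangle_\nu\qquad\forall f\in\ell_{2,\nu}.$$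
   Context: $\ell_{2,\nu}$ is the space of functions $f:S\to\mathbb R$ with $\sum_x\nu(x)f(x)^2<\infty$, with inner product $\langle f,g\rangle_\nu=\sum_x\nu(x)f(x)g(x)$. For a probability distribution $\mu$ on $S$, $\mathrm{Var}_\mu(f)=\mathbb E_\mu[f^2]-\mathbb E_\mu[f]^2$. The generator acts by $\mathcal Lf(x)=\sum_{y\in S}\mathcal L(x,y)f(y)$, where $\mathcal L(x,y)\ge0$ is the transition rate for $x\ne y$ and rows sum to $0$. Reversibility means $\nu(x)\mathcal L(x,y)=\nu(y)\mathcal L(y,x)$ for all $x,y$; the paper takes $\mathcal L$ to be a self-adjoint operator on $\ell_{2,\nu}$, i.e. $\langle f,\mathcal Lg\rangle_\nu=\langle\mathcal Lf,g\rangle_\nu$. The Dirichlet form is $\langle f,-\mathcal Lf\rangle_\nu=-\sum_{x,y\in S}\nu(x)\mathcal L(x,y)f(x)f(y)$. *)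

theory Defs
  imports "HOL-Probability.Probability"
begin

section \<open>Continuous-time Markov chains on a countable state space\<close>

text \<open>The state space is the whole (countable) type \<open>'a\<close>. A chain is given by its laws: \<open>M x\<close> is
  the law of the process \<open>X\<close> started in \<open>x\<close>.\<close>

definition trans_prob :: "('a \<Rightarrow> 'w measure) \<Rightarrow> (real \<Rightarrow> 'w \<Rightarrow> 'a) \<Rightarrow> real \<Rightarrow> 'a \<Rightarrow> 'a \<Rightarrow> real" where
  "trans_prob M X t x y = measure (M x) {\<omega> \<in> space (M x). X t \<omega> = y}"

text \<open>The fourth clause is the time-homogeneous Markov property, expressed by the finite-dimensional
  distributions; for \<open>n = 0\<close> it says that the process starts in \<open>x\<close>. The last clause says that
  paths are step functions with finitely many jumps in bounded time intervals.\<close>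

definition markov_chain :: "('a::countable \<Rightarrow> 'w measure) \<Rightarrow> (real \<Rightarrow> 'w \<Rightarrow> 'a) \<Rightarrow> bool" where
  "markov_chain M X \<longleftrightarrow>
     (\<forall>x. prob_space (M x)) \<and>
     (\<forall>x. \<forall>t\<ge>0. X t \<in> measurable (M x) (count_space UNIV)) \<and>
     (\<forall>x (n::nat) (t :: nat \<Rightarrow> real) z.
        t 0 = 0 \<and> (\<forall>i<n. t i \<le> t (Suc i)) \<and> z 0 = x \<longrightarrow>
        measure (M x) {\<omega> \<in> space (M x). \<forall>i\<le>n. X (t i) \<omega> = z i} =
          (\<Prod>i<n. trans_prob M X (t (Suc i) - t i) (z i) (z (Suc i)))) \<and>
     (\<forall>x. \<forall>\<omega> \<in> space (M x). \<forall>t\<ge>0.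
        (\<exists>e>0. \<forall>s. t \<le> s \<and> s < t + e \<longrightarrow> X s \<omega> = X t \<omega>) \<and>
        (\<exists>e>0. \<exists>z. \<forall>s\<ge>0. t - e < s \<and> s < t \<longrightarrow> X s \<omega> = z))"

definition has_generator ::
    "('a \<Rightarrow> 'w measure) \<Rightarrow> (real \<Rightarrow> 'w \<Rightarrow> 'a) \<Rightarrow> ('a \<Rightarrow> 'a \<Rightarrow> real) \<Rightarrow> bool" where
  "has_generator M X L \<longleftrightarrow>
     (\<forall>x y. x \<noteq> y \<longrightarrow> 0 \<le> L x y) \<and>
     (\<forall>x. (L x has_sum 0) UNIV) \<and>
     (\<forall>x y. ((\<lambda>t. trans_prob M X t x y) has_real_derivative L x y) (at 0 within {0..}))"

definition irreducible_chain :: "('a \<Rightarrow> 'w measure) \<Rightarrow> (real \<Rightarrow> 'w \<Rightarrow> 'a) \<Rightarrow> bool" where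
  "irreducible_chain M X \<longleftrightarrow> (\<forall>x y. \<exists>t>0. trans_prob M X t x y > 0)"

text \<open>The possible return times of a state do not lie in a lattice \<open>d\<int>\<close>.\<close>

definition aperiodic_chain :: "('a \<Rightarrow> 'w measure) \<Rightarrow> (real \<Rightarrow> 'w \<Rightarrow> 'a) \<Rightarrow> bool" where
  "aperiodic_chain M X \<longleftrightarrow>
     (\<forall>x. \<not> (\<exists>d>0. \<forall>t>0. trans_prob M X t x x > 0 \<longrightarrow> (\<exists>n::nat. t = real n * d)))"

text \<open>First return to \<open>x\<close> after having left \<open>x\<close>; it is infinite if there is no return.\<close>

definition return_time :: "(real \<Rightarrow> 'w \<Rightarrow> 'a) \<Rightarrow> 'a \<Rightarrow> 'w \<Rightarrow> ennreal" where
  "return_time X x \<omega> =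
     Inf {ennreal t | t. 0 < t \<and> X t \<omega> = x \<and> (\<exists>s. 0 < s \<and> s < t \<and> X s \<omega> \<noteq> x)}"

text \<open>As usual, an absorbing state counts as positive recurrent.\<close>

definition positive_recurrent ::
    "('a \<Rightarrow> 'w measure) \<Rightarrow> (real \<Rightarrow> 'w \<Rightarrow> 'a) \<Rightarrow> ('a \<Rightarrow> 'a \<Rightarrow> real) \<Rightarrow> bool" where
  "positive_recurrent M X L \<longleftrightarrow>
     (\<forall>x. L x x = 0 \<or> (\<integral>\<^sup>+ \<omega>. return_time X x \<omega> \<partial>M x) < \<infinity>)"

definition stationary_distribution ::
    "('a \<Rightarrow> 'w measure) \<Rightarrow> (real \<Rightarrow> 'w \<Rightarrow> 'a) \<Rightarrow> ('a \<Rightarrow> real) \<Rightarrow> bool" where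
  "stationary_distribution M X \<nu> \<longleftrightarrow>
     (\<forall>x. 0 \<le> \<nu> x) \<and> (\<nu> has_sum 1) UNIV \<and>
     (\<forall>t\<ge>0. \<forall>y. ((\<lambda>x. \<nu> x * trans_prob M X t x y) has_sum \<nu> y) UNIV)"

definition reversible :: "('a \<Rightarrow> real) \<Rightarrow> ('a \<Rightarrow> 'a \<Rightarrow> real) \<Rightarrow> bool" where
  "reversible \<nu> L \<longleftrightarrow> (\<forall>x y. \<nu> x * L x y = \<nu> y * L y x)"


section \<open>The weighted space of square-summable functions, generator and Dirichlet form\<close>

definition l2 :: "('a \<Rightarrow> real) \<Rightarrow> ('a \<Rightarrow> real) set" where
  "l2 \<nu> = {f. (\<lambda>x. \<nu> x * (f x)\<^sup>2) summable_on UNIV}"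

definition inner_l2 :: "('a \<Rightarrow> real) \<Rightarrow> ('a \<Rightarrow> real) \<Rightarrow> ('a \<Rightarrow> real) \<Rightarrow> real" where
  "inner_l2 \<nu> f g = (\<Sum>\<^sub>\<infinity>x. \<nu> x * f x * g x)"

definition gen :: "('a \<Rightarrow> 'a \<Rightarrow> real) \<Rightarrow> ('a \<Rightarrow> real) \<Rightarrow> 'a \<Rightarrow> real" where
  "gen L f x = (\<Sum>\<^sub>\<infinity>y. L x y * f y)"

definition gen_defined :: "('a \<Rightarrow> 'a \<Rightarrow> real) \<Rightarrow> ('a \<Rightarrow> real) \<Rightarrow> bool" where
  "gen_defined L f \<longleftrightarrow> (\<forall>x. (\<lambda>y. L x y * f y) summable_on UNIV)"

text \<open>The maximal domain of \<open>L\<close> as an operator on \<open>l2 \<nu>\<close>. It is all of \<open>l2 \<nu>\<close> if \<open>L\<close> acts as an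
  everywhere defined (hence bounded) operator; unbounded generators are not excluded.\<close>

definition gen_dom :: "('a \<Rightarrow> real) \<Rightarrow> ('a \<Rightarrow> 'a \<Rightarrow> real) \<Rightarrow> ('a \<Rightarrow> real) set" where
  "gen_dom \<nu> L = {f \<in> l2 \<nu>. gen_defined L f \<and> gen L f \<in> l2 \<nu>}"

definition self_adjoint_on_l2 :: "('a \<Rightarrow> real) \<Rightarrow> ('a \<Rightarrow> 'a \<Rightarrow> real) \<Rightarrow> bool" where
  "self_adjoint_on_l2 \<nu> L \<longleftrightarrow>
     (\<forall>f \<in> gen_dom \<nu> L. \<forall>g \<in> gen_dom \<nu> L. inner_l2 \<nu> f (gen L g) = inner_l2 \<nu> (gen L f) g)"

text \<open>The quadratic form is infinite for those \<open>f \<in> l2 \<nu>\<close> on which \<open>L\<close> is not defined, as is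
  customary for unbounded operators; there are none if \<open>L\<close> is everywhere defined.\<close>

definition dirichlet_form :: "('a \<Rightarrow> real) \<Rightarrow> ('a \<Rightarrow> 'a \<Rightarrow> real) \<Rightarrow> ('a \<Rightarrow> real) \<Rightarrow> ereal" where
  "dirichlet_form \<nu> L f =
     (if f \<in> gen_dom \<nu> L then ereal (inner_l2 \<nu> f (\<lambda>x. - gen L f x)) else \<infinity>)"

lemma dirichlet_form_eq:
  assumes "f \<in> gen_dom \<nu> L"
  shows "dirichlet_form \<nu> L f =
    ereal (- (\<Sum>\<^sub>\<infinity>x. \<Sum>\<^sub>\<infinity>y. \<nu> x * L x y * f x * f y))"
proof -
  have "(\<Sum>\<^sub>\<infinity>y. \<nu> x * L x y * f x * f y) = \<nu> x * f x * gen L f x" for x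
    unfolding gen_def by (subst infsum_cmult_right' [symmetric]) (simp add: mult_ac)
  with assms show ?thesis
    by (simp add: dirichlet_form_def inner_l2_def infsum_uminus)
qed

definition expect :: "('a \<Rightarrow> real) \<Rightarrow> ('a \<Rightarrow> real) \<Rightarrow> real" where
  "expect \<mu> f = (\<Sum>\<^sub>\<infinity>x. \<mu> x * f x)"

text \<open>The variance is infinite if the second moment is.\<close>

definition Var :: "('a \<Rightarrow> real) \<Rightarrow> ('a \<Rightarrow> real) \<Rightarrow> ereal" where
  "Var \<mu> f =
     (if f \<in> l2 \<mu> then ereal (expect \<mu> (\<lambda>x. (f x)\<^sup>2) - (expect \<mu> f)\<^sup>2) else \<infinity>)"

end

theory Submission imports Defs begin

text \<open>Dividing the drift condition by \<open>V\<close> gives \<open>\<gamma> \<le> - L V / V + b\<close>, and by AM-GM and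
  detailed balance \<open>\<Sum>x. \<nu> x * (g x)\<^sup>2 * (- L V x / V x) \<le> \<langle>g, - L g\<rangle>\<close>. For \<open>g = f - \<tau>(f)\<close> the remaining
  term \<open>\<Sum>x. \<nu> x * b x * (g x)\<^sup>2\<close> is a multiple of the variance of \<open>f\<close> under \<open>\<tau>\<close>, to which the local
  inequality applies.

  As \<open>L\<close> may be unbounded, the middle inequality is proved for the solutions \<open>U n\<close> of
  \<open>U n - L (U n) = g - L g\<close> on finite sets with zero boundary values, where all sums are finite.
  These converge to a solution of the equation on the whole space, which is \<open>g\<close> because
  symmetry of \<open>L\<close> on its maximal domain excludes nonzero \<open>h\<close> with \<open>L h = h\<close>. The passage to the
  limit in the term with \<open>b\<close> is dominated by a function \<open>w\<close> in the domain of \<open>L\<close>, for which the local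
  inequality itself yields \<open>\<Sum>x. \<nu> x * b x * (w x)\<^sup>2 < \<infinity>\<close>.\<close>

section \<open>Infinite sums\<close>

text \<open>Absolute summability over \<open>UNIV\<close> is integrability for the counting measure,
  and sum and integral agree there, so dominated convergence for integrals carries over.\<close>

lemma infsum_dominated_convergence:
  fixes F :: "nat \<Rightarrow> 'a \<Rightarrow> real"
  assumes lim: "\<And>x. (\<lambda>n. F n x) \<longlonglongrightarrow> f x" and bound: "\<And>n x. \<bar>F n x\<bar> \<le> G x"
    and G: "G summable_on UNIV"
  shows "f summable_on UNIV" and "(\<lambda>n. infsum (F n) UNIV) \<longlonglongrightarrow> infsum f UNIV"
proof -
  have "\<bar>F 0 x\<bar> \<le> G x" for x by (rule bound)
  then have G0: "0 \<le> G x" for x by (meson abs_ge_zero order_trans)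
  have fG: "\<bar>f x\<bar> \<le> G x" for x
    by (rule LIMSEQ_le_const2[OF tendsto_rabs[OF lim]]) (use bound in auto)
  have intG: "integrable (count_space UNIV) G"
    using G G0 by (simp flip: Infinite_Set_Sum.abs_summable_on_def abs_summable_equivalent)
  have *: "(\<lambda>x. norm (h x)) summable_on UNIV \<and> infsum h UNIV = integral\<^sup>L (count_space UNIV) h"
    if "\<And>x. \<bar>h x\<bar> \<le> G x" for h :: "'a \<Rightarrow> real"
  proof -
    have "(\<lambda>x. norm (h x)) summable_on UNIV"
      using summable_on_comparison_test[OF G] that by simp
    then show ?thesis
      using infsetsum_infsum[of h UNIV] abs_summable_equivalent[of h UNIV] by (simp add: infsetsum_def)
  qed
  show "f summable_on UNIV"
    using *[OF fG] abs_summable_summable by blast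
  have "(\<lambda>n. integral\<^sup>L (count_space UNIV) (F n)) \<longlonglongrightarrow> integral\<^sup>L (count_space UNIV) f"
    by (rule integral_dominated_convergence[where w = G]) (use lim bound intG in auto)
  then show "(\<lambda>n. infsum (F n) UNIV) \<longlonglongrightarrow> infsum f UNIV"
    using * bound fG by simp
qed

lemma nonneg_summable_on_UNIV_I:
  fixes f :: "'a \<Rightarrow> real"
  assumes "\<And>x. 0 \<le> f x" and "\<And>F. finite F \<Longrightarrow> sum f F \<le> C"
  shows "f summable_on UNIV"
  by (rule nonneg_bdd_above_summable_on) (use assms in \<open>auto intro!: bdd_aboveI[where M = C]\<close>)

lemma
  fixes f g :: "'a \<Rightarrow> real"
  assumes f: "f summable_on A" and g: "g summable_on A"
  shows summable_on_diff_real: "(\<lambda>x. f x - g x) summable_on A"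
    and infsum_diff_real: "(\<Sum>\<^sub>\<infinity>x\<in>A. f x - g x) = infsum f A - infsum g A"
proof -
  have g': "(\<lambda>x. - g x) summable_on A" using g by (simp add: summable_on_uminus)
  show "(\<lambda>x. f x - g x) summable_on A"
    using summable_on_add[OF f g'] by simp
  show "(\<Sum>\<^sub>\<infinity>x\<in>A. f x - g x) = infsum f A - infsum g A"
    using infsum_add[OF f g'] by (simp add: infsum_uminus)
qed

text \<open>Serves twice with \<open>a\<close> the mean under \<open>\<tau>\<close>: for
  \<open>\<nu>\<close> the left side then bounds the variance from above, for \<open>\<tau>\<close>
  it equals the variance.\<close>

lemma second_moment_shift:
  fixes \<mu> f :: "'a \<Rightarrow> real"
  assumes \<mu>1: "(\<mu> has_sum 1) UNIV" and \<mu>0: "\<And>x. 0 \<le> \<mu> x" and f: "f \<in> l2 \<mu>"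
  shows "(\<Sum>\<^sub>\<infinity>x. \<mu> x * (f x - a)\<^sup>2) = expect \<mu> (\<lambda>x. (f x)\<^sup>2) - 2 * a * expect \<mu> f + a\<^sup>2"
proof -
  have f2: "(\<lambda>x. \<mu> x * (f x)\<^sup>2) summable_on UNIV" using f by (simp add: l2_def)
  have \<mu>s: "\<mu> summable_on UNIV" using \<mu>1 by (auto simp: summable_on_def)
  have f1: "(\<lambda>x. \<mu> x * f x) summable_on UNIV"
  proof (rule abs_summable_summable, rule summable_on_comparison_test[OF summable_on_add[OF \<mu>s f2]])
    fix x
    have "\<bar>f x\<bar> \<le> 1 + (f x)\<^sup>2"
      using sum_squares_bound[of 1 "\<bar>f x\<bar>"] zero_le_power2[of "f x"] by simp
    from mult_left_mono[OF this \<mu>0[of x]]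
    show "norm (\<mu> x * f x) \<le> \<mu> x + \<mu> x * (f x)\<^sup>2"
      using \<mu>0[of x] by (simp add: abs_mult algebra_simps)
  qed simp
  have "((\<lambda>x. \<mu> x * (f x)\<^sup>2 + (- 2 * a) * (\<mu> x * f x) + a\<^sup>2 * \<mu> x) has_sum
      expect \<mu> (\<lambda>x. (f x)\<^sup>2) + (- 2 * a) * expect \<mu> f + a\<^sup>2 * 1) UNIV"
    unfolding expect_def
    by (intro has_sum_add has_sum_cmult_right has_sum_infsum f1 f2 \<mu>1)
  moreover have "\<mu> x * (f x - a)\<^sup>2 = \<mu> x * (f x)\<^sup>2 + (- 2 * a) * (\<mu> x * f x) + a\<^sup>2 * \<mu> x" for x
    by (simp add: power2_eq_square algebra_simps)
  ultimately show ?thesis by (simp add: infsumI)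
qed

section \<open>The Dirichlet problem on finite sets\<close>

text \<open>Jacobi iteration for \<open>u - L u = \<phi>\<close> on \<open>A\<close>: the equation
  at \<open>x\<close> is solved for \<open>u x\<close>. With the diagonal moved to the denominator,
  the remaining coefficients are nonnegative rates, so for \<open>\<phi> \<ge> 0\<close> the
  iterates increase from 0.\<close>

primrec jacobi :: "('a \<Rightarrow> 'a \<Rightarrow> real) \<Rightarrow> 'a set \<Rightarrow> ('a \<Rightarrow> real) \<Rightarrow> nat \<Rightarrow> 'a \<Rightarrow> real" where
  "jacobi L A \<phi> 0 x = 0"
| "jacobi L A \<phi> (Suc k) x =
    (if x \<in> A then (\<phi> x + (\<Sum>y\<in>A - {x}. L x y * jacobi L A \<phi> k y)) / (1 - L x x) else 0)"

text \<open>For finite \<open>A\<close> and \<open>\<phi> \<ge> 0\<close> this is the function \<open>u\<close> vanishing outside \<open>A\<close> that solves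
  \<open>u - L u = \<phi>\<close> on \<open>A\<close>; the limit is junk if the iteration diverges.\<close>

definition fin_resolvent :: "('a \<Rightarrow> 'a \<Rightarrow> real) \<Rightarrow> 'a set \<Rightarrow> ('a \<Rightarrow> real) \<Rightarrow> 'a \<Rightarrow> real" where
  "fin_resolvent L A \<phi> x = lim (\<lambda>k. jacobi L A \<phi> k x)"

definition exhaustion :: "nat \<Rightarrow> 'a::countable set" where
  "exhaustion n = {x. to_nat x < n}"

lemma finite_exhaustion [simp]: "finite (exhaustion n)"
  unfolding exhaustion_def by (rule finite_imageD[of to_nat]) (auto intro: finite_subset[of _ "{..<n}"])

lemma exhaustion_mono: "m \<le> n \<Longrightarrow> exhaustion m \<subseteq> exhaustion n"
  by (auto simp: exhaustion_def)

lemma eventually_in_exhaustion: "\<forall>\<^sub>F n in sequentially. x \<in> exhaustion n"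
  using eventually_gt_at_top[of "to_nat x"] by (simp add: exhaustion_def)

lemma eventually_subset_exhaustion:
  "finite F \<Longrightarrow> \<forall>\<^sub>F n in sequentially. F \<subseteq> exhaustion n"
  unfolding subset_eq by (intro eventually_ball_finite ballI eventually_in_exhaustion)

text \<open>Plays the part of the inverse of \<open>1 - L\<close> applied to \<open>\<phi>\<close>.
  For nonnegative \<open>\<phi>\<close> in \<open>l2 \<nu>\<close> the limit exists by monotonicity
  and the energy bound.\<close>

definition full_resolvent :: "('a::countable \<Rightarrow> 'a \<Rightarrow> real) \<Rightarrow> ('a \<Rightarrow> real) \<Rightarrow> 'a \<Rightarrow> real" where
  "full_resolvent L \<phi> x = lim (\<lambda>n. fin_resolvent L (exhaustion n) \<phi> x)"

locale reversible_rates =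
  fixes \<nu> :: "'a::countable \<Rightarrow> real" and L :: "'a \<Rightarrow> 'a \<Rightarrow> real"
  assumes \<nu>_pos: "0 < \<nu> x"
    and rate_nonneg: "x \<noteq> y \<Longrightarrow> 0 \<le> L x y"
    and rate_sum: "(L x has_sum 0) UNIV"
    and detailed_balance: "\<nu> x * L x y = \<nu> y * L y x"
begin

text \<open>The whole row sums to 0 and the omitted entries are nonnegative;
  \<open>x \<in> A\<close> keeps the diagonal, the only entry that may be negative.\<close>

lemma rate_sum_le_0: "finite A \<Longrightarrow> x \<in> A \<Longrightarrow> (\<Sum>y\<in>A. L x y) \<le> 0"
  by (rule finite_sum_le_has_sum[OF rate_sum]) (auto intro!: rate_nonneg)

lemma rate_sum_le: "finite A \<Longrightarrow> (\<Sum>y\<in>A - {x}. L x y) \<le> - L x x"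
  using rate_sum_le_0[of "insert x A" x] by (simp add: sum.insert_remove)

lemma rate_diag_le_0: "L x x \<le> 0"
  using rate_sum_le_0[of "{x}" x] by simp

lemma jacobi_nonneg: "(\<And>x. 0 \<le> \<phi> x) \<Longrightarrow> 0 \<le> jacobi L A \<phi> k x"
proof (induction k arbitrary: x)
  case (Suc k)
  then show ?case using rate_diag_le_0[of x]
    by (auto intro!: divide_nonneg_nonneg add_nonneg_nonneg sum_nonneg mult_nonneg_nonneg rate_nonneg)
qed simp

text \<open>All coefficients of the recursion are nonnegative, so enlarging the set or iterating
  further only adds nonnegative contributions. Growth in \<open>k\<close> gives convergence of the
  iteration, growth in the set gives monotonicity along the exhaustion.\<close>

lemma jacobi_mono:
  assumes \<phi>: "\<And>x. 0 \<le> \<phi> x" and AB: "A \<subseteq> B" "finite B" and "k \<le> l"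
  shows "jacobi L A \<phi> k x \<le> jacobi L B \<phi> l x"
  using \<open>k \<le> l\<close>
proof (induction k arbitrary: l x)
  case 0
  then show ?case using jacobi_nonneg[OF \<phi>] by simp
next
  case (Suc k)
  then obtain m where l: "l = Suc m" "k \<le> m" by (cases l) auto
  show ?case
  proof (cases "x \<in> A")
    case True
    have "(\<Sum>y\<in>A - {x}. L x y * jacobi L A \<phi> k y) \<le> (\<Sum>y\<in>A - {x}. L x y * jacobi L B \<phi> m y)"
      using Suc.IH[OF l(2)] rate_nonneg by (intro sum_mono mult_left_mono) auto
    also have "\<dots> \<le> (\<Sum>y\<in>B - {x}. L x y * jacobi L B \<phi> m y)"
      using AB rate_nonneg jacobi_nonneg[OF \<phi>] by (intro sum_mono2) auto
    finally show ?thesis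
      using True AB l rate_diag_le_0[of x] by (auto intro!: divide_right_mono)
  next
    case False
    then show ?thesis using jacobi_nonneg[OF \<phi>, where A = B and k = l and x = x] by simp
  qed
qed

text \<open>The constant \<open>sum \<phi> A\<close> is a supersolution: partial row sums are at
  most 0 and the constant dominates \<open>\<phi>\<close> on \<open>A\<close>. The iteration starts
  below it and stays below.\<close>

lemma jacobi_le:
  assumes \<phi>: "\<And>x. 0 \<le> \<phi> x" and A: "finite A"
  shows "jacobi L A \<phi> k x \<le> sum \<phi> A"
proof (induction k arbitrary: x)
  case 0
  then show ?case using \<phi> by (simp add: sum_nonneg)
next
  case (Suc k)
  let ?c = "sum \<phi> A"
  have c: "0 \<le> ?c" using \<phi> by (simp add: sum_nonneg)
  show ?case
  proof (cases "x \<in> A")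
    case True
    have "(\<Sum>y\<in>A - {x}. L x y * jacobi L A \<phi> k y) \<le> (\<Sum>y\<in>A - {x}. L x y * ?c)"
      using Suc.IH rate_nonneg by (intro sum_mono mult_left_mono) auto
    also have "\<dots> \<le> - L x x * ?c"
      unfolding sum_distrib_right[symmetric] by (intro mult_right_mono rate_sum_le A c)
    finally have "\<phi> x + (\<Sum>y\<in>A - {x}. L x y * jacobi L A \<phi> k y) \<le> ?c * (1 - L x x)"
      using member_le_sum[of x A \<phi>] True A \<phi> by (simp add: algebra_simps)
    then show ?thesis
      using True rate_diag_le_0[of x] by (simp add: divide_le_eq)
  next
    case False
    then show ?thesis using c by simp
  qed
qed

lemma jacobi_tendsto:
  assumes "\<And>x. 0 \<le> \<phi> x" and "finite A"
  shows "(\<lambda>k. jacobi L A \<phi> k x) \<longlonglongrightarrow> fin_resolvent L A \<phi> x"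
proof -
  have "Bseq (\<lambda>k. jacobi L A \<phi> k x)"
    using jacobi_nonneg[OF assms(1)] jacobi_le[OF assms]
    by (intro BseqI'[of _ "sum \<phi> A"]) auto
  moreover have "incseq (\<lambda>k. jacobi L A \<phi> k x)"
    using jacobi_mono[OF assms(1) order_refl assms(2)] by (auto simp: incseq_def)
  ultimately show ?thesis
    unfolding fin_resolvent_def using Bseq_monoseq_convergent convergent_LIMSEQ_iff incseq_imp_monoseq
    by blast
qed

lemma fin_resolvent_nonneg:
  assumes "\<And>x. 0 \<le> \<phi> x" and "finite A"
  shows "0 \<le> fin_resolvent L A \<phi> x"
  by (rule LIMSEQ_le_const[OF jacobi_tendsto[OF assms]]) (use jacobi_nonneg[OF assms(1)] in auto)

lemma fin_resolvent_mono:
  assumes "\<And>x. 0 \<le> \<phi> x" and "A \<subseteq> B" "finite B"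
  shows "fin_resolvent L A \<phi> x \<le> fin_resolvent L B \<phi> x"
  by (rule LIMSEQ_le[OF jacobi_tendsto jacobi_tendsto])
    (use assms jacobi_mono[OF assms order_refl] finite_subset in auto)

lemma fin_resolvent_outside: "x \<notin> A \<Longrightarrow> fin_resolvent L A \<phi> x = 0"
proof -
  assume "x \<notin> A"
  then have "jacobi L A \<phi> k x = 0" for k by (cases k) auto
  then show ?thesis by (simp add: fin_resolvent_def)
qed

lemma fin_resolvent_eq:
  assumes \<phi>: "\<And>x. 0 \<le> \<phi> x" and A: "finite A" and x: "x \<in> A"
  shows "fin_resolvent L A \<phi> x - (\<Sum>y\<in>A. L x y * fin_resolvent L A \<phi> y) = \<phi> x"
proof -
  let ?u = "fin_resolvent L A \<phi>"
  have "(\<lambda>k. (\<phi> x + (\<Sum>y\<in>A - {x}. L x y * jacobi L A \<phi> k y)) / (1 - L x x))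
      \<longlonglongrightarrow> (\<phi> x + (\<Sum>y\<in>A - {x}. L x y * ?u y)) / (1 - L x x)"
    using rate_diag_le_0[of x] by (intro tendsto_intros jacobi_tendsto \<phi> A) auto
  moreover have "(\<lambda>k. jacobi L A \<phi> (Suc k) x) \<longlonglongrightarrow> ?u x"
    using LIMSEQ_Suc[OF jacobi_tendsto[OF \<phi> A]] .
  ultimately have "?u x = (\<phi> x + (\<Sum>y\<in>A - {x}. L x y * ?u y)) / (1 - L x x)"
    using x LIMSEQ_unique by force
  then have "?u x * (1 - L x x) = \<phi> x + (\<Sum>y\<in>A - {x}. L x y * ?u y)"
    using rate_diag_le_0[of x] by (simp add: field_simps)
  then show ?thesis
    using sum.remove[OF A x, of "\<lambda>y. L x y * ?u y"] by (simp add: algebra_simps)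
qed

text \<open>Right side minus left side is the double sum of \<open>h\<close> below. Pairing
  \<open>(x, y)\<close> with \<open>(y, x)\<close> and using detailed balance, each off-diagonal
  pair becomes a nonnegative rate times the square of \<open>u x * V y - u y * V x\<close> over
  \<open>V x * V y\<close>. The diagonal terms cancel, whatever the sign of
  \<open>L x x\<close>.\<close>

lemma hardy_inequality_finite:
  assumes A: "finite A" and V: "\<And>x. x \<in> A \<Longrightarrow> 0 < V x"
  shows "(\<Sum>x\<in>A. \<nu> x * (u x)\<^sup>2 * (- (\<Sum>y\<in>A. L x y * V y) / V x))
    \<le> (\<Sum>x\<in>A. \<nu> x * u x * - (\<Sum>y\<in>A. L x y * u y))"
proof -
  define a where "a x y = \<nu> x * L x y" for x y
  have sym: "a x y = a y x" for x y unfolding a_def by (rule detailed_balance)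
  define h where "h x y = a x y * ((u x)\<^sup>2 * V y / V x - u x * u y)" for x y
  have "0 \<le> h x y + h y x" if "x \<in> A" "y \<in> A" for x y
  proof (cases "x = y")
    case True
    then show ?thesis using V[OF that(1)] by (simp add: h_def power2_eq_square)
  next
    case False
    have "h x y + h y x = a x y * ((u x)\<^sup>2 * V y / V x + (u y)\<^sup>2 * V x / V y - 2 * u x * u y)"
      by (simp add: h_def sym[of y x] algebra_simps)
    also have "\<dots> = a x y * ((u x * V y - u y * V x)\<^sup>2 / (V x * V y))"
      using V[OF that(1)] V[OF that(2)] by (simp add: field_simps power2_eq_square)
    also have "\<dots> \<ge> 0"
      using V[OF that(1)] V[OF that(2)] rate_nonneg[OF False] \<nu>_pos[of x] by (simp add: a_def)
    finally show ?thesis .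
  qed
  then have "0 \<le> (\<Sum>x\<in>A. \<Sum>y\<in>A. h x y + h y x)" by (simp add: sum_nonneg)
  also have "\<dots> = 2 * (\<Sum>x\<in>A. \<Sum>y\<in>A. h x y)"
    by (simp add: sum.distrib sum.swap[of "\<lambda>x y. h y x"])
  also have "(\<Sum>x\<in>A. \<Sum>y\<in>A. h x y) =
      (\<Sum>x\<in>A. \<nu> x * u x * - (\<Sum>y\<in>A. L x y * u y)) -
      (\<Sum>x\<in>A. \<nu> x * (u x)\<^sup>2 * (- (\<Sum>y\<in>A. L x y * V y) / V x))"
    by (simp add: h_def a_def sum_distrib_left sum_divide_distrib sum_subtractf[symmetric]
        sum_negf[symmetric] algebra_simps)
  finally show ?thesis by simp
qed

text \<open>The solution map is a contraction in the weighted norm, uniformly in \<open>A\<close>.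
  This is what survives the exhaustion of an infinite space.\<close>

lemma fin_energy_bound:
  assumes A: "finite A" and u: "\<And>x. x \<in> A \<Longrightarrow> u x - (\<Sum>y\<in>A. L x y * u y) = \<phi> x"
  shows "(\<Sum>x\<in>A. \<nu> x * (u x)\<^sup>2) \<le> (\<Sum>x\<in>A. \<nu> x * (\<phi> x)\<^sup>2)"
proof -
  \<comment> \<open>The Hardy inequality with \<open>V = 1\<close> shows that the quadratic form of
    \<open>- L\<close> restricted to \<open>A\<close> is nonnegative.\<close>
  have "0 \<le> (\<Sum>x\<in>A. \<nu> x * (u x)\<^sup>2 * (- (\<Sum>y\<in>A. L x y * 1) / 1))"
    using rate_sum_le_0[OF A] \<nu>_pos by (intro sum_nonneg mult_nonneg_nonneg) (auto simp: less_imp_le)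
  also have "\<dots> \<le> (\<Sum>x\<in>A. \<nu> x * u x * - (\<Sum>y\<in>A. L x y * u y))"
    by (rule hardy_inequality_finite[OF A]) simp
  also have "\<dots> = (\<Sum>x\<in>A. \<nu> x * u x * (\<phi> x - u x))"
    by (intro sum.cong refl) (simp flip: u)
  also have "2 * \<dots> \<le> (\<Sum>x\<in>A. \<nu> x * (\<phi> x)\<^sup>2 - \<nu> x * (u x)\<^sup>2)"
    unfolding sum_distrib_left
  proof (rule sum_mono)
    fix x
    have "0 \<le> \<nu> x * (u x - \<phi> x)\<^sup>2" using \<nu>_pos[of x] by simp
    then show "2 * (\<nu> x * u x * (\<phi> x - u x)) \<le> \<nu> x * (\<phi> x)\<^sup>2 - \<nu> x * (u x)\<^sup>2"
      by (simp add: power2_eq_square algebra_simps)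
  qed
  finally show ?thesis by (simp add: sum_subtractf)
qed

section \<open>Square-summable functions and the domain of the generator\<close>

lemma l2_add: "f \<in> l2 \<nu> \<Longrightarrow> g \<in> l2 \<nu> \<Longrightarrow> (\<lambda>x. f x + g x) \<in> l2 \<nu>"
  and l2_diff: "f \<in> l2 \<nu> \<Longrightarrow> g \<in> l2 \<nu> \<Longrightarrow> (\<lambda>x. f x - g x) \<in> l2 \<nu>"
  and l2_mult_summable: "f \<in> l2 \<nu> \<Longrightarrow> g \<in> l2 \<nu> \<Longrightarrow> (\<lambda>x. \<nu> x * f x * g x) summable_on UNIV"
proof -
  assume "f \<in> l2 \<nu>" "g \<in> l2 \<nu>"
  then have f: "(\<lambda>x. \<nu> x * (f x)\<^sup>2) summable_on UNIV"
    and g: "(\<lambda>x. \<nu> x * (g x)\<^sup>2) summable_on UNIV"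
    by (auto simp: l2_def)
  have fg: "(\<lambda>x. \<nu> x * (f x)\<^sup>2 + \<nu> x * (g x)\<^sup>2) summable_on UNIV"
    by (rule summable_on_add[OF f g])
  show *: "(\<lambda>x. \<nu> x * f x * g x) summable_on UNIV"
  proof (rule abs_summable_summable, rule summable_on_comparison_test[OF fg])
    fix x
    have "\<bar>f x * g x\<bar> \<le> (f x)\<^sup>2 + (g x)\<^sup>2"
      using sum_squares_bound[of "\<bar>f x\<bar>" "\<bar>g x\<bar>"] by (simp add: abs_mult mult.assoc)
        (smt (verit) zero_le_power2 mult_nonneg_nonneg abs_ge_zero)
    from mult_left_mono[OF this, of "\<nu> x"]
    show "norm (\<nu> x * f x * g x) \<le> \<nu> x * (f x)\<^sup>2 + \<nu> x * (g x)\<^sup>2"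
      using \<nu>_pos[of x] by (simp add: abs_mult algebra_simps)
  qed simp
  have "(\<lambda>x. \<nu> x * (f x)\<^sup>2 + \<nu> x * (g x)\<^sup>2 + 2 * (\<nu> x * f x * g x)) summable_on UNIV"
    by (intro summable_on_add[OF fg] summable_on_cmult_right *)
  then show "(\<lambda>x. f x + g x) \<in> l2 \<nu>"
    unfolding l2_def by (simp add: power2_eq_square algebra_simps)
  have "(\<lambda>x. \<nu> x * (f x)\<^sup>2 + \<nu> x * (g x)\<^sup>2 + (-2) * (\<nu> x * f x * g x)) summable_on UNIV"
    by (intro summable_on_add[OF fg] summable_on_cmult_right *)
  then show "(\<lambda>x. f x - g x) \<in> l2 \<nu>"
    unfolding l2_def by (simp add: power2_eq_square algebra_simps)
qed

lemma gen_add: "gen_defined L f \<Longrightarrow> gen_defined L g \<Longrightarrow> gen L (\<lambda>x. f x + g x) x = gen L f x + gen L g x"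
  and gen_defined_add: "gen_defined L f \<Longrightarrow> gen_defined L g \<Longrightarrow> gen_defined L (\<lambda>x. f x + g x)"
  unfolding gen_def gen_defined_def by (simp_all add: distrib_left infsum_add summable_on_add)

lemma gen_diff: "gen_defined L f \<Longrightarrow> gen_defined L g \<Longrightarrow> gen L (\<lambda>x. f x - g x) x = gen L f x - gen L g x"
  and gen_defined_diff: "gen_defined L f \<Longrightarrow> gen_defined L g \<Longrightarrow> gen_defined L (\<lambda>x. f x - g x)"
  unfolding gen_def gen_defined_def by (simp_all add: right_diff_distrib infsum_diff_real summable_on_diff_real)

lemma gen_dom_add: "f \<in> gen_dom \<nu> L \<Longrightarrow> g \<in> gen_dom \<nu> L \<Longrightarrow> (\<lambda>x. f x + g x) \<in> gen_dom \<nu> L"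
proof -
  assume "f \<in> gen_dom \<nu> L" "g \<in> gen_dom \<nu> L"
  moreover from this have "gen L (\<lambda>x. f x + g x) = (\<lambda>x. gen L f x + gen L g x)"
    by (intro ext gen_add) (auto simp: gen_dom_def)
  ultimately show ?thesis by (simp add: gen_dom_def l2_add gen_defined_add)
qed

lemma gen_dom_diff: "f \<in> gen_dom \<nu> L \<Longrightarrow> g \<in> gen_dom \<nu> L \<Longrightarrow> (\<lambda>x. f x - g x) \<in> gen_dom \<nu> L"
proof -
  assume "f \<in> gen_dom \<nu> L" "g \<in> gen_dom \<nu> L"
  moreover from this have "gen L (\<lambda>x. f x - g x) = (\<lambda>x. gen L f x - gen L g x)"
    by (intro ext gen_diff) (auto simp: gen_dom_def)
  ultimately show ?thesis by (simp add: gen_dom_def l2_diff gen_defined_diff)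
qed

section \<open>The resolvent on the whole state space\<close>

text \<open>Nonnegative data make the finite solutions increase along the exhaustion; data of either
  sign are treated afterwards by splitting.\<close>

context
  fixes \<phi> :: "'a \<Rightarrow> real"
  assumes \<phi>_nonneg: "\<And>x. 0 \<le> \<phi> x" and \<phi>_l2: "\<phi> \<in> l2 \<nu>"
begin

lemma fin_resolvent_l2_bound:
  assumes "F \<subseteq> A" "finite A"
  shows "(\<Sum>x\<in>F. \<nu> x * (fin_resolvent L A \<phi> x)\<^sup>2) \<le> (\<Sum>\<^sub>\<infinity>x. \<nu> x * (\<phi> x)\<^sup>2)"
proof -
  have "(\<Sum>x\<in>F. \<nu> x * (fin_resolvent L A \<phi> x)\<^sup>2) \<le> (\<Sum>x\<in>A. \<nu> x * (fin_resolvent L A \<phi> x)\<^sup>2)"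
    using assms \<nu>_pos by (intro sum_mono2) (auto simp: less_imp_le)
  also have "\<dots> \<le> (\<Sum>x\<in>A. \<nu> x * (\<phi> x)\<^sup>2)"
    by (intro fin_energy_bound fin_resolvent_eq \<phi>_nonneg assms)
  also have "\<dots> \<le> (\<Sum>\<^sub>\<infinity>x. \<nu> x * (\<phi> x)\<^sup>2)"
    using \<phi>_l2 \<nu>_pos assms by (intro finite_sum_le_infsum) (auto simp: l2_def less_imp_le)
  finally show ?thesis .
qed

lemma full_resolvent_tendsto:
  "(\<lambda>n. fin_resolvent L (exhaustion n) \<phi> x) \<longlonglongrightarrow> full_resolvent L \<phi> x"
proof -
  let ?C = "\<Sum>\<^sub>\<infinity>x. \<nu> x * (\<phi> x)\<^sup>2"
  have "0 \<le> ?C" using \<nu>_pos by (intro infsum_nonneg) (simp add: less_imp_le)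
  \<comment> \<open>A single term of the energy bound already controls the value at
    \<open>x\<close>, since \<open>\<nu> x\<close> is positive.\<close>
  have "\<bar>fin_resolvent L (exhaustion n) \<phi> x\<bar> \<le> sqrt (?C / \<nu> x)" for n
  proof (cases "x \<in> exhaustion n")
    case True
    then show ?thesis
      using fin_resolvent_l2_bound[of "{x}" "exhaustion n"] \<nu>_pos[of x]
      by (intro real_le_rsqrt) (simp add: pos_le_divide_eq mult.commute)
  next
    case False
    then show ?thesis using \<open>0 \<le> ?C\<close> \<nu>_pos[of x] by (simp add: fin_resolvent_outside)
  qed
  then have "Bseq (\<lambda>n. fin_resolvent L (exhaustion n) \<phi> x)"
    by (intro BseqI'[of _ "sqrt (?C / \<nu> x)"]) simp
  moreover have "incseq (\<lambda>n. fin_resolvent L (exhaustion n) \<phi> x)"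
    unfolding incseq_def by (intro allI impI fin_resolvent_mono \<phi>_nonneg exhaustion_mono) auto
  ultimately show ?thesis
    unfolding full_resolvent_def using Bseq_monoseq_convergent convergent_LIMSEQ_iff incseq_imp_monoseq
    by blast
qed

lemma fin_resolvent_le_full: "fin_resolvent L (exhaustion n) \<phi> x \<le> full_resolvent L \<phi> x"
proof (rule LIMSEQ_le_const[OF full_resolvent_tendsto], intro exI allI impI)
  fix m assume "n \<le> m"
  then show "fin_resolvent L (exhaustion n) \<phi> x \<le> fin_resolvent L (exhaustion m) \<phi> x"
    by (intro fin_resolvent_mono \<phi>_nonneg exhaustion_mono) auto
qed

lemma full_resolvent_nonneg: "0 \<le> full_resolvent L \<phi> x"
  using fin_resolvent_nonneg[of \<phi> "exhaustion 0" x] fin_resolvent_le_full[of 0 x] \<phi>_nonneg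
  by simp

text \<open>A Fatou argument: every finite set eventually lies in the exhaustion, where the energy
  bound holds with a constant independent of \<open>n\<close>.\<close>

lemma full_resolvent_l2: "full_resolvent L \<phi> \<in> l2 \<nu>"
proof -
  have "(\<lambda>x. \<nu> x * (full_resolvent L \<phi> x)\<^sup>2) summable_on UNIV"
  proof (rule nonneg_summable_on_UNIV_I)
    fix F :: "'a set" assume F: "finite F"
    show "(\<Sum>x\<in>F. \<nu> x * (full_resolvent L \<phi> x)\<^sup>2) \<le> (\<Sum>\<^sub>\<infinity>x. \<nu> x * (\<phi> x)\<^sup>2)"
    proof (rule tendsto_upperbound)
      show "(\<lambda>n. \<Sum>x\<in>F. \<nu> x * (fin_resolvent L (exhaustion n) \<phi> x)\<^sup>2)
          \<longlonglongrightarrow> (\<Sum>x\<in>F. \<nu> x * (full_resolvent L \<phi> x)\<^sup>2)"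
        by (intro tendsto_intros full_resolvent_tendsto)
      show "\<forall>\<^sub>F n in sequentially. (\<Sum>x\<in>F. \<nu> x * (fin_resolvent L (exhaustion n) \<phi> x)\<^sup>2)
          \<le> (\<Sum>\<^sub>\<infinity>x. \<nu> x * (\<phi> x)\<^sup>2)"
        using eventually_subset_exhaustion[OF F]
        by eventually_elim (simp add: fin_resolvent_l2_bound)
    qed simp
  qed (use \<nu>_pos in \<open>simp add: less_imp_le\<close>)
  then show ?thesis by (simp add: l2_def)
qed

text \<open>The limit solves \<open>u - L u = \<phi>\<close>. The equations on finite sets first
  bound the partial row sums, which gives absolute summability of \<open>L x y * u y\<close> over
  \<open>y\<close>; dominated convergence then carries the equations themselves to the
  limit.\<close>

lemma full_resolvent_has_sum:
  "((\<lambda>y. L x y * full_resolvent L \<phi> y) has_sum (full_resolvent L \<phi> x - \<phi> x)) UNIV"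
proof -
  let ?u = "full_resolvent L \<phi>" and ?U = "\<lambda>n. fin_resolvent L (exhaustion n) \<phi>"
  \<comment> \<open>As \<open>F\<close> contains \<open>x\<close>, only terms with nonnegative rates
    are added when passing from \<open>F\<close> to the exhaustion.\<close>
  have fin: "(\<Sum>y\<in>F. L x y * ?U n y) \<le> ?U n x - \<phi> x"
    if "F \<subseteq> exhaustion n" "x \<in> F" for F n
  proof -
    have "(\<Sum>y\<in>F. L x y * ?U n y) \<le> (\<Sum>y\<in>exhaustion n. L x y * ?U n y)"
      using that by (intro sum_mono2)
        (auto intro!: mult_nonneg_nonneg rate_nonneg fin_resolvent_nonneg \<phi>_nonneg)
    also have "\<dots> = ?U n x - \<phi> x"
      using fin_resolvent_eq[of \<phi> "exhaustion n" x] \<phi>_nonneg that by force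
    finally show ?thesis .
  qed
  have lim: "(\<Sum>y\<in>F. L x y * ?u y) \<le> ?u x - \<phi> x" if F: "finite F" "x \<in> F" for F
  proof (rule tendsto_le)
    show "(\<lambda>n. \<Sum>y\<in>F. L x y * ?U n y) \<longlonglongrightarrow> (\<Sum>y\<in>F. L x y * ?u y)"
      by (intro tendsto_intros full_resolvent_tendsto)
    show "(\<lambda>n. ?U n x - \<phi> x) \<longlonglongrightarrow> ?u x - \<phi> x"
      by (intro tendsto_intros full_resolvent_tendsto)
    show "\<forall>\<^sub>F n in sequentially. (\<Sum>y\<in>F. L x y * ?U n y) \<le> ?U n x - \<phi> x"
      using eventually_subset_exhaustion[OF F(1)] by eventually_elim (use fin F(2) in blast)
  qed simp
  have "(\<lambda>y. \<bar>L x y\<bar> * ?u y) summable_on UNIV"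
  proof (rule nonneg_summable_on_UNIV_I)
    fix F :: "'a set" assume F: "finite F"
    have "(\<Sum>y\<in>F. \<bar>L x y\<bar> * ?u y) \<le> (\<Sum>y\<in>insert x F. \<bar>L x y\<bar> * ?u y)"
      using F full_resolvent_nonneg by (intro sum_mono2) auto
    \<comment> \<open>The absolute value changes only the diagonal term, from
      \<open>L x x * ?u x\<close> to its negative.\<close>
    also have "\<dots> = (\<Sum>y\<in>insert x F. L x y * ?u y) - 2 * L x x * ?u x"
    proof -
      have "(\<Sum>y\<in>F - {x}. \<bar>L x y\<bar> * ?u y) = (\<Sum>y\<in>F - {x}. L x y * ?u y)"
        using rate_nonneg[of x] by (intro sum.cong refl) (metis DiffE abs_of_nonneg insertI1)
      then show ?thesis
        using F rate_diag_le_0[of x] by (simp add: sum.insert_remove algebra_simps)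
    qed
    also have "\<dots> \<le> ?u x - \<phi> x - 2 * L x x * ?u x"
      using lim[of "insert x F"] F by simp
    finally show "(\<Sum>y\<in>F. \<bar>L x y\<bar> * ?u y) \<le> ?u x - \<phi> x - 2 * L x x * ?u x" .
  qed (simp add: full_resolvent_nonneg)
  note dom = infsum_dominated_convergence[OF _ _ this, of "\<lambda>n y. L x y * ?U n y" "\<lambda>y. L x y * ?u y"]
  have pt: "(\<lambda>n. L x y * ?U n y) \<longlonglongrightarrow> L x y * ?u y" for y
    by (intro tendsto_intros full_resolvent_tendsto)
  have bd: "\<bar>L x y * ?U n y\<bar> \<le> \<bar>L x y\<bar> * ?u y" for n y
    using fin_resolvent_nonneg[OF \<phi>_nonneg, where A = "exhaustion n" and x = y] fin_resolvent_le_full[of n y]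
    by (simp add: abs_mult mult_left_mono)
  have "(\<lambda>n. ?U n x - \<phi> x) \<longlonglongrightarrow> (\<Sum>\<^sub>\<infinity>y. L x y * ?u y)"
  proof (rule Lim_transform_eventually[OF dom(2)[OF pt bd]])
    show "\<forall>\<^sub>F n in sequentially. (\<Sum>\<^sub>\<infinity>y. L x y * ?U n y) = ?U n x - \<phi> x"
      using eventually_in_exhaustion[of x]
    proof eventually_elim
      case (elim n)
      have "(\<Sum>\<^sub>\<infinity>y. L x y * ?U n y) = (\<Sum>\<^sub>\<infinity>y\<in>exhaustion n. L x y * ?U n y)"
        by (rule infsum_cong_neutral) (auto simp: fin_resolvent_outside)
      then show ?case
        using fin_resolvent_eq[of \<phi> "exhaustion n" x] \<phi>_nonneg elim by force
    qed
  qed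
  moreover have "(\<lambda>n. ?U n x - \<phi> x) \<longlonglongrightarrow> ?u x - \<phi> x"
    by (intro tendsto_intros full_resolvent_tendsto)
  ultimately have "(\<Sum>\<^sub>\<infinity>y. L x y * ?u y) = ?u x - \<phi> x"
    by (rule LIMSEQ_unique)
  then show ?thesis
    using has_sum_infsum[OF dom(1)[OF pt bd]] by simp
qed

lemma gen_full_resolvent: "gen L (full_resolvent L \<phi>) x = full_resolvent L \<phi> x - \<phi> x"
  unfolding gen_def by (rule infsumI[OF full_resolvent_has_sum])

lemma full_resolvent_gen_dom: "full_resolvent L \<phi> \<in> gen_dom \<nu> L"
proof -
  have "gen L (full_resolvent L \<phi>) = (\<lambda>x. full_resolvent L \<phi> x - \<phi> x)"
    by (intro ext gen_full_resolvent)
  then show ?thesis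
    using full_resolvent_has_sum
    by (auto simp: gen_dom_def gen_defined_def summable_on_def full_resolvent_l2 \<phi>_l2 l2_diff)
qed

end

text \<open>Splits \<open>\<phi>\<close> into positive and negative parts: \<open>u\<close> and
  \<open>U n\<close> are differences of the two resolvents, \<open>w\<close> is the sum of the full
  ones. Thus the dominating function itself lies in \<open>gen_dom \<nu> L\<close>, which a bound by
  an arbitrary square-summable function would not provide.\<close>

lemma resolvent_approximation:
  assumes "\<phi> \<in> l2 \<nu>"
  obtains u w U where "u \<in> gen_dom \<nu> L" "w \<in> gen_dom \<nu> L"
    and "\<And>x. u x - gen L u x = \<phi> x"
    and "\<And>x. (\<lambda>n. U n x) \<longlonglongrightarrow> u x"
    and "\<And>n x. \<bar>U n x\<bar> \<le> w x"
    and "\<And>n x. x \<notin> exhaustion n \<Longrightarrow> U n x = 0"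
    and "\<And>n x. x \<in> exhaustion n \<Longrightarrow> U n x - (\<Sum>y\<in>exhaustion n. L x y * U n y) = \<phi> x"
proof -
  define p where "p x = max 0 (\<phi> x)" for x
  define m where "m x = max 0 (- \<phi> x)" for x
  have pm: "p x - m x = \<phi> x" and p0: "0 \<le> p x" and m0: "0 \<le> m x" for x
    by (auto simp: p_def m_def)
  have l2_le: "h \<in> l2 \<nu>" if h: "\<And>x. \<bar>h x\<bar> \<le> \<bar>\<phi> x\<bar>" for h
    unfolding l2_def mem_Collect_eq
  proof (rule summable_on_comparison_test)
    show "(\<lambda>x. \<nu> x * (\<phi> x)\<^sup>2) summable_on UNIV" using assms by (simp add: l2_def)
    show "\<nu> x * (h x)\<^sup>2 \<le> \<nu> x * (\<phi> x)\<^sup>2" for x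
      using h[of x] \<nu>_pos[of x] by (simp add: abs_le_square_iff)
    show "0 \<le> \<nu> x * (h x)\<^sup>2" for x
      using \<nu>_pos[of x] by simp
  qed
  have p: "p \<in> l2 \<nu>" and m: "m \<in> l2 \<nu>"
    by (rule l2_le; simp add: p_def m_def)+
  let ?Up = "\<lambda>n. fin_resolvent L (exhaustion n) p" and ?Um = "\<lambda>n. fin_resolvent L (exhaustion n) m"
  let ?u = "\<lambda>x. full_resolvent L p x - full_resolvent L m x"
  let ?w = "\<lambda>x. full_resolvent L p x + full_resolvent L m x"
  let ?U = "\<lambda>n x. ?Up n x - ?Um n x"
  note dp = full_resolvent_gen_dom[OF p0 p] and dm = full_resolvent_gen_dom[OF m0 m]
  show ?thesis
  proof (rule that[of ?u ?w ?U])
    show "?u \<in> gen_dom \<nu> L" by (rule gen_dom_diff[OF dp dm])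
    show "?w \<in> gen_dom \<nu> L" by (rule gen_dom_add[OF dp dm])
    show "?u x - gen L ?u x = \<phi> x" for x
      using dp dm pm[of x]
      by (simp add: gen_dom_def gen_diff gen_full_resolvent[OF p0 p] gen_full_resolvent[OF m0 m])
    show "(\<lambda>n. ?U n x) \<longlonglongrightarrow> ?u x" for x
      by (intro tendsto_diff full_resolvent_tendsto p0 p m0 m)
    show "\<bar>?U n x\<bar> \<le> ?w x" for n x
      using fin_resolvent_le_full[OF p0 p, of n x] fin_resolvent_le_full[OF m0 m, of n x]
        fin_resolvent_nonneg[of p "exhaustion n" x] fin_resolvent_nonneg[of m "exhaustion n" x] p0 m0
      by simp
    show "?U n x = 0" if "x \<notin> exhaustion n" for n x
      using that by (simp add: fin_resolvent_outside)
    show "?U n x - (\<Sum>y\<in>exhaustion n. L x y * ?U n y) = \<phi> x" if "x \<in> exhaustion n" for n x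
      using fin_resolvent_eq[of p "exhaustion n" x] fin_resolvent_eq[of m "exhaustion n" x]
        p0 m0 pm[of x] that by (simp add: right_diff_distrib sum_subtractf)
  qed
qed

text \<open>Solve \<open>v - L v = h\<close>. Then the squared norm of \<open>h\<close> is the inner
  product of \<open>h\<close> with \<open>v - L v\<close>, and symmetry turns it into that of
  \<open>h - L h = 0\<close> with \<open>v\<close>.\<close>

lemma gen_fixpoint_zero:
  assumes sa: "self_adjoint_on_l2 \<nu> L" and h: "h \<in> gen_dom \<nu> L" and fp: "\<And>x. gen L h x = h x"
  shows "h x = 0"
proof -
  have hl2: "h \<in> l2 \<nu>" using h by (simp add: gen_dom_def)
  from resolvent_approximation[OF hl2] obtain v
    where v: "v \<in> gen_dom \<nu> L" and eq: "\<And>x. v x - gen L v x = h x" by metis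
  have "inner_l2 \<nu> h (gen L v) = inner_l2 \<nu> (gen L h) v"
    using sa h v by (simp add: self_adjoint_on_l2_def)
  also have "gen L h = h" using fp by auto
  finally have *: "inner_l2 \<nu> h (gen L v) = inner_l2 \<nu> h v" .
  have "inner_l2 \<nu> h v - inner_l2 \<nu> h (gen L v) = (\<Sum>\<^sub>\<infinity>x. \<nu> x * h x * v x - \<nu> x * h x * gen L v x)"
    unfolding inner_l2_def by (rule infsum_diff_real[symmetric])
      (use v hl2 in \<open>auto simp: gen_dom_def l2_mult_summable\<close>)
  also have "\<dots> = (\<Sum>\<^sub>\<infinity>x. \<nu> x * (h x)\<^sup>2)"
    by (intro infsum_cong) (simp add: eq[symmetric] power2_eq_square algebra_simps)
  finally have "(\<Sum>\<^sub>\<infinity>x. \<nu> x * (h x)\<^sup>2) = 0" using * by simp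
  moreover have "sum (\<lambda>x. \<nu> x * (h x)\<^sup>2) {x} \<le> (\<Sum>\<^sub>\<infinity>x. \<nu> x * (h x)\<^sup>2)"
    using hl2 \<nu>_pos by (intro finite_sum_le_infsum) (auto simp: l2_def less_imp_le)
  ultimately have "\<nu> x * (h x)\<^sup>2 \<le> 0" by simp
  then show ?thesis using \<nu>_pos[of x] by (simp add: mult_le_0_iff)
qed

section \<open>The Lyapunov estimate\<close>

lemma lyapunov_estimate:
  fixes V b g :: "'a \<Rightarrow> real" and \<gamma> :: real
  assumes sa: "self_adjoint_on_l2 \<nu> L" and V: "\<And>x. 1 \<le> V x" and b: "\<And>x. 0 \<le> b x"
    and LV: "gen_defined L V" and drift: "\<And>x. gen L V x \<le> - \<gamma> * V x + b x"
    and b_dom: "\<And>w. w \<in> gen_dom \<nu> L \<Longrightarrow> (\<lambda>x. b x * \<nu> x * (w x)\<^sup>2) summable_on UNIV"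
    and g: "g \<in> gen_dom \<nu> L"
  shows "\<gamma> * (\<Sum>\<^sub>\<infinity>x. \<nu> x * (g x)\<^sup>2)
    \<le> inner_l2 \<nu> g (\<lambda>x. - gen L g x) + (\<Sum>\<^sub>\<infinity>x. b x * \<nu> x * (g x)\<^sup>2)"
proof -
  define \<phi> where "\<phi> x = g x - gen L g x" for x
  have gl2: "g \<in> l2 \<nu>" and Lgl2: "gen L g \<in> l2 \<nu>" using g by (auto simp: gen_dom_def)
  have \<phi>: "\<phi> \<in> l2 \<nu>" using l2_diff[OF gl2 Lgl2] by (simp add: \<phi>_def[abs_def])
  obtain u w U where u: "u \<in> gen_dom \<nu> L" and w: "w \<in> gen_dom \<nu> L"
    and ueq: "\<And>x. u x - gen L u x = \<phi> x"
    and lim: "\<And>x. (\<lambda>n. U n x) \<longlonglongrightarrow> u x"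
    and Uw: "\<And>n x. \<bar>U n x\<bar> \<le> w x"
    and U0: "\<And>n x. x \<notin> exhaustion n \<Longrightarrow> U n x = 0"
    and Ueq: "\<And>n x. x \<in> exhaustion n \<Longrightarrow> U n x - (\<Sum>y\<in>exhaustion n. L x y * U n y) = \<phi> x"
    using resolvent_approximation[OF \<phi>] by blast
  \<comment> \<open>Both \<open>u\<close> and \<open>g\<close> solve the same resolvent equation, so
    their difference is fixed by \<open>L\<close>.\<close>
  have "u x - g x = 0" for x
  proof (rule gen_fixpoint_zero[OF sa gen_dom_diff[OF u g]])
    fix x
    have "gen L (\<lambda>x. u x - g x) x = gen L u x - gen L g x"
      using u g by (intro gen_diff) (auto simp: gen_dom_def)
    then show "gen L (\<lambda>x. u x - g x) x = u x - g x"
      using ueq[of x] by (simp add: \<phi>_def)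
  qed
  then have lim: "(\<lambda>n. U n x) \<longlonglongrightarrow> g x" for x using lim[of x] by simp
  have wl2: "w \<in> l2 \<nu>" using w by (simp add: gen_dom_def)
  have w0: "0 \<le> w x" for x using Uw[of 0 x] by simp
  \<comment> \<open>On the exhaustion \<open>- L (U n) = \<phi> - U n\<close>, so \<open>H n\<close>
    is the integrand of the desired inequality for \<open>U n\<close>, written without
    \<open>L\<close>. The extra 1 in \<open>\<gamma> + 1\<close> comes from the term
    \<open>- U n\<close>.\<close>
  define H where "H n x = \<nu> x * U n x * \<phi> x + b x * \<nu> x * (U n x)\<^sup>2 - (\<gamma> + 1) * (\<nu> x * (U n x)\<^sup>2)" for n x
  have "0 \<le> infsum (H n) UNIV" for n
  proof -
    let ?A = "exhaustion n :: 'a set"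
    have "(\<Sum>x\<in>?A. \<nu> x * (U n x)\<^sup>2 * (\<gamma> - b x))
        \<le> (\<Sum>x\<in>?A. \<nu> x * (U n x)\<^sup>2 * (- (\<Sum>y\<in>?A. L x y * V y) / V x))"
    proof (intro sum_mono mult_left_mono)
      fix x assume x: "x \<in> ?A"
      \<comment> \<open>Truncation drops only off-diagonal terms, which are nonnegative, so the
        drift condition survives on finite sets.\<close>
      have "(\<Sum>y\<in>?A. L x y * V y) \<le> gen L V x"
        unfolding gen_def
      proof (rule finite_sum_le_infsum)
        show "(\<lambda>y. L x y * V y) summable_on UNIV" using LV by (simp add: gen_defined_def)
        show "0 \<le> L x y * V y" if "y \<in> UNIV - ?A" for y
          using that x V[of y] by (intro mult_nonneg_nonneg rate_nonneg) auto
      qed auto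
      also have "\<dots> \<le> - \<gamma> * V x + b x" by (rule drift)
      \<comment> \<open>Here \<open>V x \<ge> 1\<close> enters, so that dividing by
        \<open>V x\<close> leaves at most \<open>b x\<close>.\<close>
      also have "\<dots> \<le> (b x - \<gamma>) * V x"
        using mult_left_mono[OF V[of x] b[of x]] by (simp add: algebra_simps)
      finally show "\<gamma> - b x \<le> - (\<Sum>y\<in>?A. L x y * V y) / V x"
        using V[of x] by (simp add: field_simps)
    qed (use \<nu>_pos in \<open>simp add: less_imp_le\<close>)
    also have "\<dots> \<le> (\<Sum>x\<in>?A. \<nu> x * U n x * - (\<Sum>y\<in>?A. L x y * U n y))"
      by (rule hardy_inequality_finite) (use V in \<open>auto intro: less_le_trans[OF zero_less_one]\<close>)
    also have "\<dots> = (\<Sum>x\<in>?A. \<nu> x * U n x * (\<phi> x - U n x))"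
      by (intro sum.cong refl) (simp flip: Ueq)
    also have "\<dots> = sum (H n) ?A + (\<Sum>x\<in>?A. \<nu> x * (U n x)\<^sup>2 * (\<gamma> - b x))"
      unfolding sum.distrib[symmetric]
      by (intro sum.cong refl) (simp add: H_def power2_eq_square algebra_simps)
    finally have "0 \<le> sum (H n) ?A" by simp
    also have "sum (H n) ?A = infsum (H n) ?A" by simp
    also have "\<dots> = infsum (H n) UNIV"
      by (rule infsum_cong_neutral) (auto simp: H_def U0)
    finally show ?thesis .
  qed
  moreover have "(\<lambda>n. infsum (H n) UNIV) \<longlonglongrightarrow>
      (\<Sum>\<^sub>\<infinity>x. \<nu> x * g x * \<phi> x + b x * \<nu> x * (g x)\<^sup>2 - (\<gamma> + 1) * (\<nu> x * (g x)\<^sup>2))"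
  proof (rule infsum_dominated_convergence(2))
    show "(\<lambda>n. H n x) \<longlonglongrightarrow> \<nu> x * g x * \<phi> x + b x * \<nu> x * (g x)\<^sup>2 - (\<gamma> + 1) * (\<nu> x * (g x)\<^sup>2)" for x
      unfolding H_def by (intro tendsto_intros lim)
    show "\<bar>H n x\<bar> \<le> \<bar>\<nu> x * w x * \<phi> x\<bar> + b x * \<nu> x * (w x)\<^sup>2 + \<bar>\<gamma> + 1\<bar> * (\<nu> x * (w x)\<^sup>2)" for n x
    proof -
      have sq: "(U n x)\<^sup>2 \<le> (w x)\<^sup>2" using Uw[of n x] by (simp add: abs_le_square_iff[symmetric] w0)
      have "\<bar>\<nu> x * U n x * \<phi> x\<bar> \<le> \<bar>\<nu> x * w x * \<phi> x\<bar>"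
        using Uw[of n x] w0[of x] by (simp add: abs_mult mult_left_mono mult_right_mono)
      moreover have "\<bar>b x * \<nu> x * (U n x)\<^sup>2\<bar> \<le> b x * \<nu> x * (w x)\<^sup>2"
        using sq b[of x] \<nu>_pos[of x] by (simp add: abs_mult mult_left_mono)
      moreover have "\<bar>(\<gamma> + 1) * (\<nu> x * (U n x)\<^sup>2)\<bar> \<le> \<bar>\<gamma> + 1\<bar> * (\<nu> x * (w x)\<^sup>2)"
        using sq \<nu>_pos[of x] by (simp add: abs_mult mult_left_mono)
      ultimately show ?thesis unfolding H_def by linarith
    qed
    have "(\<lambda>x. norm (\<nu> x * w x * \<phi> x)) summable_on UNIV"
      using l2_mult_summable[OF wl2 \<phi>] by (rule summable_on_iff_abs_summable_on_real[THEN iffD1])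
    then show "(\<lambda>x. \<bar>\<nu> x * w x * \<phi> x\<bar> + b x * \<nu> x * (w x)\<^sup>2 + \<bar>\<gamma> + 1\<bar> * (\<nu> x * (w x)\<^sup>2)) summable_on UNIV"
      using b_dom[OF w] wl2 unfolding l2_def
      by (intro summable_on_add summable_on_cmult_right) auto
  qed
  ultimately have "0 \<le> (\<Sum>\<^sub>\<infinity>x. \<nu> x * g x * \<phi> x + b x * \<nu> x * (g x)\<^sup>2 - (\<gamma> + 1) * (\<nu> x * (g x)\<^sup>2))"
    by (intro LIMSEQ_le_const) auto
  \<comment> \<open>Inserting \<open>\<phi> = g - L g\<close> cancels the extra 1 in
    \<open>\<gamma> + 1\<close>.\<close>
  also have "\<dots> = (\<Sum>\<^sub>\<infinity>x. \<nu> x * g x * (- gen L g x) + b x * \<nu> x * (g x)\<^sup>2 - \<gamma> * (\<nu> x * (g x)\<^sup>2))"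
    by (intro infsum_cong) (simp add: \<phi>_def power2_eq_square algebra_simps)
  also have "\<dots> = inner_l2 \<nu> g (\<lambda>x. - gen L g x) + (\<Sum>\<^sub>\<infinity>x. b x * \<nu> x * (g x)\<^sup>2)
      - \<gamma> * (\<Sum>\<^sub>\<infinity>x. \<nu> x * (g x)\<^sup>2)"
  proof -
    have 1: "(\<lambda>x. \<nu> x * g x * (- gen L g x)) summable_on UNIV"
      using l2_mult_summable[OF gl2 Lgl2] by (simp add: summable_on_uminus)
    have 2: "(\<lambda>x. \<nu> x * (g x)\<^sup>2) summable_on UNIV" using gl2 by (simp add: l2_def)
    show ?thesis
      unfolding inner_l2_def
      using infsum_diff_real[OF summable_on_add[OF 1 b_dom[OF g]] summable_on_cmult_right[OF 2, of \<gamma>]]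
        infsum_add[OF 1 b_dom[OF g]] infsum_cmult_right[OF 2, of \<gamma>] by simp
  qed
  finally show ?thesis by simp
qed

section \<open>Constants and the passage from the local to the global inequality\<close>

lemma gen_const: "gen L (\<lambda>_. a) x = 0" and gen_defined_const: "gen_defined L (\<lambda>_. a)"
proof -
  have "((\<lambda>y. L x y * a) has_sum 0) UNIV" for x
    using has_sum_cmult_left[OF rate_sum[of x], of a] by simp
  then show "gen L (\<lambda>_. a) x = 0" "gen_defined L (\<lambda>_. a)"
    by (auto simp: gen_def gen_defined_def summable_on_def intro: infsumI)
qed

lemma gen_dom_const: "\<nu> summable_on UNIV \<Longrightarrow> (\<lambda>_. a) \<in> gen_dom \<nu> L"
  using gen_const[of a]
  by (simp add: gen_dom_def l2_def gen_defined_const summable_on_cmult_left)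

text \<open>\<open>L\<close> annihilates constants, and the cross term, the inner product of
  \<open>a\<close> with \<open>L f\<close>, vanishes by moving \<open>L\<close> onto the
  constant.\<close>

lemma inner_gen_diff_const:
  assumes sa: "self_adjoint_on_l2 \<nu> L" and \<nu>: "\<nu> summable_on UNIV" and f: "f \<in> gen_dom \<nu> L"
  shows "inner_l2 \<nu> (\<lambda>x. f x - a) (\<lambda>x. - gen L (\<lambda>x. f x - a) x) = inner_l2 \<nu> f (\<lambda>x. - gen L f x)"
proof -
  have fl: "f \<in> l2 \<nu>" "gen L f \<in> l2 \<nu>" "gen_defined L f" using f by (auto simp: gen_dom_def)
  have cl: "(\<lambda>_. a) \<in> l2 \<nu>" using gen_dom_const[OF \<nu>] by (simp add: gen_dom_def)
  have "gen L (\<lambda>x. f x - a) x = gen L f x" for x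
    using gen_diff[OF fl(3) gen_defined_const[of a], of x] by (simp add: gen_const)
  then have "inner_l2 \<nu> (\<lambda>x. f x - a) (\<lambda>x. - gen L (\<lambda>x. f x - a) x)
      = (\<Sum>\<^sub>\<infinity>x. \<nu> x * a * gen L f x - \<nu> x * f x * gen L f x)"
    unfolding inner_l2_def by (intro infsum_cong) (simp add: algebra_simps)
  also have "\<dots> = inner_l2 \<nu> (\<lambda>_. a) (gen L f) - inner_l2 \<nu> f (gen L f)"
    unfolding inner_l2_def by (intro infsum_diff_real l2_mult_summable fl cl)
  also have "inner_l2 \<nu> (\<lambda>_. a) (gen L f) = inner_l2 \<nu> (gen L (\<lambda>_. a)) f"
    using sa f gen_dom_const[OF \<nu>, of a] by (simp add: self_adjoint_on_l2_def)
  also have "\<dots> = 0" by (simp add: inner_l2_def gen_const)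
  finally show ?thesis by (simp add: inner_l2_def infsum_uminus)
qed

text \<open>The constant \<open>c\<close> stands for the ratio of \<open>C\<^sub>b\<close> and the
  mass of \<open>K\<close>. The local inequality is assumed on the domain of \<open>L\<close>, where
  its right side is finite.\<close>

lemma poincare_from_local:
  fixes V b f :: "'a \<Rightarrow> real" and \<gamma> c :: real
  defines "\<tau> \<equiv> (\<lambda>x. b x * \<nu> x / (\<Sum>\<^sub>\<infinity>x. b x * \<nu> x))"
  assumes sa: "self_adjoint_on_l2 \<nu> L" and \<nu>: "(\<nu> has_sum 1) UNIV"
    and V: "\<And>x. 1 \<le> V x" and b: "\<And>x. 0 \<le> b x" and "0 < \<gamma>"
    and LV: "gen_defined L V" and drift: "\<And>x. gen L V x \<le> - \<gamma> * V x + b x"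
    and bs: "(\<lambda>x. b x * \<nu> x) summable_on UNIV" and B_pos: "0 < (\<Sum>\<^sub>\<infinity>x. b x * \<nu> x)"
    and loc: "\<And>f. f \<in> gen_dom \<nu> L \<Longrightarrow> Var \<tau> f \<le> ereal (c * inner_l2 \<nu> f (\<lambda>x. - gen L f x))"
    and f: "f \<in> gen_dom \<nu> L"
  shows "Var \<nu> f \<le> ereal ((1 + (\<Sum>\<^sub>\<infinity>x. b x * \<nu> x) * c) / \<gamma> * inner_l2 \<nu> f (\<lambda>x. - gen L f x))"
proof -
  define B where "B = (\<Sum>\<^sub>\<infinity>x. b x * \<nu> x)"
  define E where "E = inner_l2 \<nu> f (\<lambda>x. - gen L f x)"
  have B: "0 < B" using B_pos by (simp add: B_def)
  have B\<tau>: "B * \<tau> x = b x * \<nu> x" for x using B by (simp add: \<tau>_def B_def)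
  have \<tau>0: "0 \<le> \<tau> x" for x
    using b[of x] \<nu>_pos[of x] B by (simp add: \<tau>_def flip: B_def)
  have \<tau>1: "(\<tau> has_sum 1) UNIV"
    using has_sum_cmult_left[OF has_sum_infsum[OF bs], of "1 / B"] B
    by (simp add: \<tau>_def[abs_def] flip: B_def)
  \<comment> \<open>\<open>Var \<tau> w\<close> is infinite outside \<open>l2 \<tau>\<close>, so a
    finite bound on it forces membership. This yields the summability against \<open>b\<close> that
    the Lyapunov estimate requires.\<close>
  have l2\<tau>: "w \<in> l2 \<tau>" if "w \<in> gen_dom \<nu> L" for w
  proof (rule ccontr)
    assume "w \<notin> l2 \<tau>"
    then have "Var \<tau> w = \<infinity>" by (simp add: Var_def)
    then show False using loc[OF that] by simp
  qed
  have b_dom: "(\<lambda>x. b x * \<nu> x * (w x)\<^sup>2) summable_on UNIV" if "w \<in> gen_dom \<nu> L" for w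
    using summable_on_cmult_right[of "\<lambda>x. \<tau> x * (w x)\<^sup>2" UNIV B] l2\<tau>[OF that]
    by (simp add: l2_def B\<tau> flip: mult.assoc)
  define a where "a = expect \<tau> f"
  define g where "g x = f x - a" for x
  have \<nu>s: "\<nu> summable_on UNIV" using \<nu> by (auto simp: summable_on_def)
  have g: "g \<in> gen_dom \<nu> L"
    unfolding g_def[abs_def] by (rule gen_dom_diff[OF f gen_dom_const[OF \<nu>s]])
  have fl2: "f \<in> l2 \<nu>" using f by (simp add: gen_dom_def)
  \<comment> \<open>The second moment about \<open>a\<close> exceeds the variance by the square of
    \<open>expect \<nu> f - a\<close>.\<close>
  have "Var \<nu> f \<le> ereal (\<Sum>\<^sub>\<infinity>x. \<nu> x * (g x)\<^sup>2)"
    using second_moment_shift[OF \<nu> less_imp_le[OF \<nu>_pos] fl2, of a] zero_le_power2[of "expect \<nu> f - a"] fl2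
    by (simp add: Var_def g_def power2_eq_square algebra_simps)
  moreover have "\<gamma> * (\<Sum>\<^sub>\<infinity>x. \<nu> x * (g x)\<^sup>2) \<le> E + (\<Sum>\<^sub>\<infinity>x. b x * \<nu> x * (g x)\<^sup>2)"
    using lyapunov_estimate[OF sa V b LV drift b_dom g] inner_gen_diff_const[OF sa \<nu>s f, of a]
    by (simp add: E_def g_def[abs_def])
  moreover have "(\<Sum>\<^sub>\<infinity>x. b x * \<nu> x * (g x)\<^sup>2) \<le> B * (c * E)"
  proof -
    have "(\<Sum>\<^sub>\<infinity>x. b x * \<nu> x * (g x)\<^sup>2) = (\<Sum>\<^sub>\<infinity>x. B * (\<tau> x * (g x)\<^sup>2))"
      by (simp add: B\<tau> flip: mult.assoc)
    also have "\<dots> = B * (\<Sum>\<^sub>\<infinity>x. \<tau> x * (g x)\<^sup>2)"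
      by (rule infsum_cmult_right) (use l2\<tau>[OF g] in \<open>simp add: l2_def\<close>)
    \<comment> \<open>As \<open>a\<close> is the mean of \<open>f\<close> under
      \<open>\<tau>\<close>, the left side is exactly \<open>Var \<tau> f\<close>.\<close>
    also have "(\<Sum>\<^sub>\<infinity>x. \<tau> x * (g x)\<^sup>2) \<le> c * E"
      using second_moment_shift[OF \<tau>1 \<tau>0 l2\<tau>[OF f], of a] loc[OF f] l2\<tau>[OF f]
      by (simp add: Var_def g_def E_def a_def power2_eq_square)
    finally show ?thesis using B by simp
  qed
  ultimately have "Var \<nu> f \<le> ereal (\<Sum>\<^sub>\<infinity>x. \<nu> x * (g x)\<^sup>2)"
    and "\<gamma> * (\<Sum>\<^sub>\<infinity>x. \<nu> x * (g x)\<^sup>2) \<le> (1 + B * c) * E"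
    by (auto simp: algebra_simps)
  then show ?thesis
    using \<open>0 < \<gamma>\<close> unfolding B_def[symmetric] E_def[symmetric]
    by (elim order_trans) (simp add: field_simps)
qed

end

section \<open>Positivity of the stationary distribution and the inequality for the chain\<close>

text \<open>Some state \<open>x\<close> carries mass because the total is 1. Irreducibility gives a
  time at which \<open>y\<close> is reached from \<open>x\<close> with positive probability, and
  invariance at that time transports mass to \<open>y\<close>.\<close>

lemma stationary_distribution_pos:
  assumes st: "stationary_distribution M X \<nu>" and irr: "irreducible_chain M X"
  shows "0 < \<nu> y"
proof -
  have nn: "0 \<le> \<nu> x" and sum1: "(\<nu> has_sum 1) UNIV"
    and inv: "t \<ge> 0 \<Longrightarrow> ((\<lambda>x. \<nu> x * trans_prob M X t x y) has_sum \<nu> y) UNIV" for x t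
    using st by (auto simp: stationary_distribution_def)
  have "\<exists>x. \<nu> x \<noteq> 0"
  proof (rule ccontr)
    assume "\<nexists>x. \<nu> x \<noteq> 0"
    then have "infsum \<nu> UNIV = 0" by (intro infsum_0) simp
    then show False using infsumI[OF sum1] by simp
  qed
  then obtain x where "\<nu> x \<noteq> 0" by blast
  with nn[of x] have x: "0 < \<nu> x" by simp
  obtain t where t: "t > 0" "trans_prob M X t x y > 0"
    using irr by (auto simp: irreducible_chain_def)
  have "(\<Sum>z\<in>{x}. \<nu> z * trans_prob M X t z y) \<le> \<nu> y"
    by (rule finite_sum_le_has_sum[OF inv]) (use t nn in \<open>auto simp: trans_prob_def\<close>)
  moreover have "0 < \<nu> x * trans_prob M X t x y" using x t by simp
  ultimately show ?thesis by simp
qed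

theorem theorem2:
  fixes M :: "'a::countable \<Rightarrow> 'w measure" and X :: "real \<Rightarrow> 'w \<Rightarrow> 'a"
    and L :: "'a \<Rightarrow> 'a \<Rightarrow> real" and \<nu> \<nu>\<^sub>K \<tau> V b :: "'a \<Rightarrow> real"
    and K :: "'a set" and \<gamma> C\<^sub>b :: real
  defines "K \<equiv> {q. b q > 0}"
    and "\<tau> \<equiv> (\<lambda>q. b q * \<nu> q / (\<Sum>\<^sub>\<infinity>x. b x * \<nu> x))"
    and "\<nu>\<^sub>K \<equiv> (\<lambda>q. if q \<in> K then \<nu> q / (\<Sum>\<^sub>\<infinity>x\<in>K. \<nu> x) else 0)"
  assumes "markov_chain M X" and "has_generator M X L"
    and "irreducible_chain M X" and "aperiodic_chain M X" and "positive_recurrent M X L"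
    and "stationary_distribution M X \<nu>" and "reversible \<nu> L" and "self_adjoint_on_l2 \<nu> L"
    and "\<forall>q. V q \<ge> 1" and "\<forall>q. b q \<ge> 0" and "\<gamma> > 0"
    and "gen_defined L V" and "\<forall>q. gen L V q \<le> - \<gamma> * V q + b q"
    and "(\<lambda>q. b q * \<nu> q) summable_on UNIV" and "K \<noteq> {}" and "C\<^sub>b \<ge> 0"
    and "\<forall>f \<in> l2 \<nu>. Var \<tau> f \<le> ereal (C\<^sub>b / (\<Sum>\<^sub>\<infinity>q\<in>K. \<nu> q)) * dirichlet_form \<nu> L f"
  shows "\<forall>f \<in> l2 \<nu>.
    Var \<nu> f \<le> ereal ((1 + (\<Sum>\<^sub>\<infinity>q. b q * \<nu>\<^sub>K q) * C\<^sub>b) / \<gamma>) * dirichlet_form \<nu> L f"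
proof
  fix f assume "f \<in> l2 \<nu>"
  define m where "m = (\<Sum>\<^sub>\<infinity>q\<in>K. \<nu> q)"
  define B where "B = (\<Sum>\<^sub>\<infinity>q. b q * \<nu> q)"
  note st = \<open>stationary_distribution M X \<nu>\<close> and gen = \<open>has_generator M X L\<close>
    and sa = \<open>self_adjoint_on_l2 \<nu> L\<close>
    and K_nonempty = \<open>K \<noteq> {}\<close>
    and b_summable = \<open>(\<lambda>q. b q * \<nu> q) summable_on UNIV\<close>
    and V_ge_1 = \<open>\<forall>q. V q \<ge> 1\<close>
    and drift = \<open>\<forall>q. gen L V q \<le> - \<gamma> * V q + b q\<close>
    and \<gamma>_pos = \<open>\<gamma> > 0\<close>
    and C_nonneg = \<open>C\<^sub>b \<ge> 0\<close>
    and LV = \<open>gen_defined L V\<close>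
    and rev = \<open>reversible \<nu> L\<close>
    and loc = \<open>\<forall>f \<in> l2 \<nu>. Var \<tau> f \<le> ereal (C\<^sub>b / (\<Sum>\<^sub>\<infinity>q\<in>K. \<nu> q)) * dirichlet_form \<nu> L f\<close>
  note b_nonneg = \<open>\<forall>q. b q \<ge> 0\<close>[rule_format]
  have \<nu>_pos: "0 < \<nu> x" for x
    by (rule stationary_distribution_pos[OF st \<open>irreducible_chain M X\<close>])
  interpret reversible_rates \<nu> L
  proof
    show "0 < \<nu> x" for x by (rule \<nu>_pos)
    show "0 \<le> L x y" if "x \<noteq> y" for x y using gen that unfolding has_generator_def by blast
    show "(L x has_sum 0) UNIV" for x using gen unfolding has_generator_def by blast
    show "\<nu> x * L x y = \<nu> y * L y x" for x y
      using rev unfolding reversible_def by blast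
  qed
  have \<nu>1: "(\<nu> has_sum 1) UNIV" using st unfolding stationary_distribution_def by blast
  obtain k where k: "k \<in> K" using K_nonempty by blast
  have "(\<Sum>q\<in>{k}. \<nu> q) \<le> m"
    unfolding m_def
  proof (rule finite_sum_le_infsum)
    show "\<nu> summable_on K"
      by (rule summable_on_subset_banach[OF has_sum_imp_summable[OF \<nu>1] subset_UNIV])
  qed (use k \<nu>_pos in \<open>auto simp: less_imp_le\<close>)
  then have m: "0 < m" using \<nu>_pos[of k] by simp
  have "(\<Sum>q\<in>{k}. b q * \<nu> q) \<le> B"
    unfolding B_def using b_summable b_nonneg \<nu>_pos
    by (intro finite_sum_le_infsum) (auto simp: less_imp_le)
  moreover have "0 < b k * \<nu> k" using k \<nu>_pos[of k] by (simp add: K_def)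
  ultimately have B: "0 < B" by simp
  \<comment> \<open>Off \<open>K\<close> both sides vanish, since \<open>b\<close> is nonnegative
    and hence 0 there.\<close>
  have "b q * \<nu>\<^sub>K q = b q * \<nu> q * (1 / m)" for q
    using b_nonneg[of q] by (auto simp: \<nu>\<^sub>K_def m_def K_def)
  then have b_sum: "(\<Sum>\<^sub>\<infinity>q. b q * \<nu>\<^sub>K q) = B / m"
    using infsum_cmult_left'[of "\<lambda>q. b q * \<nu> q" "1 / m" UNIV] by (simp add: B_def)
  show "Var \<nu> f \<le> ereal ((1 + (\<Sum>\<^sub>\<infinity>q. b q * \<nu>\<^sub>K q) * C\<^sub>b) / \<gamma>) * dirichlet_form \<nu> L f"
  proof (cases "f \<in> gen_dom \<nu> L")
    case True
    have "Var \<nu> f \<le> ereal ((1 + B * (C\<^sub>b / m)) / \<gamma> * inner_l2 \<nu> f (\<lambda>x. - gen L f x))"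
      unfolding B_def
    proof (rule poincare_from_local[OF sa \<nu>1, of V])
      show "Var (\<lambda>x. b x * \<nu> x / (\<Sum>\<^sub>\<infinity>x. b x * \<nu> x)) h
          \<le> ereal (C\<^sub>b / m * inner_l2 \<nu> h (\<lambda>x. - gen L h x))" if h: "h \<in> gen_dom \<nu> L" for h
      proof -
        have "h \<in> l2 \<nu>" using h by (simp add: gen_dom_def)
        then have "Var \<tau> h \<le> ereal (C\<^sub>b / m) * dirichlet_form \<nu> L h"
          using loc unfolding m_def by blast
        then show ?thesis using h by (simp add: \<tau>_def dirichlet_form_def)
      qed
      show "1 \<le> V x" for x using V_ge_1 by blast
      show "gen L V x \<le> - \<gamma> * V x + b x" for x
        using drift by blast
      show "0 < (\<Sum>\<^sub>\<infinity>q. b q * \<nu> q)" using B by (simp only: B_def)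
    qed (fact b_nonneg \<gamma>_pos LV b_summable True)+
    then show ?thesis using True by (simp add: dirichlet_form_def b_sum)
  next
    case False
    \<comment> \<open>Outside the domain the form is infinite. Strict positivity of the constant
      matters, because 0 times infinity is 0 in \<open>ereal\<close>; the summand 1 ensures it even
      for \<open>C\<^sub>b = 0\<close>.\<close>
    have "0 < (1 + B / m * C\<^sub>b) / \<gamma>"
      using B m \<gamma>_pos C_nonneg by (intro divide_pos_pos add_pos_nonneg) auto
    moreover have "ereal d * \<infinity> = \<infinity>" if "0 < d" for d
      using that by simp
    ultimately show ?thesis
      using False unfolding dirichlet_form_def b_sum by (simp only: if_False ereal_less_eq)
  qed
qed

end
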